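(* Let $G$ be an $n$-vertex graph, let $s=n^{1/3}(11\lg n)^{2/3}$, and suppose that $n$ is large enough that $s\le n-2$. If $G$ has average degree $d$ and $d>2$, then $$f(G) > \frac{d}{4s}\left(1-\frac{2}{d}\right)\left(1-\frac{1}{s}\right)\left(1-\frac{4s^2}{d-2}\right).$$
   Context: $\lg$ denotes the base-2 logarithm. An edge-ordering of a graph $G$ is a total ordering of $E(G)$. In an edge-ordered graph, a monotone path is a path $x_0x_1\ldots x_k$ whose edges $x_0x_1,\ldots,x_{k-1}x_k$ are increasing in the edge ordering; its length is $k$. The altitude $f(G)$ of $G$ is the largest integer $k$ such that every edge-ordering of $G$ contains a monotone path of length $k$. *)

theory Defs
  imports Complex_Main
begin

definition simple_graph :: "'a set \<Rightarrow> 'a set set \<Rightarrow> bool" where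
  "simple_graph V E \<longleftrightarrow> finite V \<and> (\<forall>e\<in>E. e \<subseteq> V \<and> card e = 2)"

definition degree :: "'a set set \<Rightarrow> 'a \<Rightarrow> nat" where
  "degree E v = card {e \<in> E. v \<in> e}"

definition average_degree :: "'a set \<Rightarrow> 'a set set \<Rightarrow> real" where
  "average_degree V E = (\<Sum>v\<in>V. real (degree E v)) / real (card V)"

definition path_edges :: "'a list \<Rightarrow> 'a set list" where
  "path_edges xs = map (\<lambda>(x, y). {x, y}) (zip xs (tl xs))"

(* A path is the list of its vertices, so its length is the length of the list minus one;
   a single vertex is a path of length 0. *)
definition is_path :: "'a set \<Rightarrow> 'a set set \<Rightarrow> 'a list \<Rightarrow> bool" where
  "is_path V E xs \<longleftrightarrow>
     xs \<noteq> [] \<and> distinct xs \<and> set xs \<subseteq> V \<and> set (path_edges xs) \<subseteq> E"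

definition path_length :: "'a list \<Rightarrow> nat" where
  "path_length xs = length xs - 1"

(* An edge-ordering is the reflexive linear order r on E; "increasing" is strict. *)
definition monotone_path ::
    "'a set \<Rightarrow> 'a set set \<Rightarrow> ('a set \<times> 'a set) set \<Rightarrow> 'a list \<Rightarrow> bool" where
  "monotone_path V E r xs \<longleftrightarrow>
     is_path V E xs \<and> sorted_wrt (\<lambda>e e'. (e, e') \<in> r \<and> e \<noteq> e') (path_edges xs)"

(* For a finite nonempty V the greatest k exists: k = 0 always qualifies, and no path is
   longer than card V - 1. *)
definition altitude :: "'a set \<Rightarrow> 'a set set \<Rightarrow> nat" where
  "altitude V E = (GREATEST k. \<forall>r. linear_order_on E r \<longrightarrow>
     (\<exists>xs. monotone_path V E r xs \<and> path_length xs = k))"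

end

theory Submission
  imports Defs
begin

text \<open>
  Arrange the edges in a table whose columns are the vertices: in decreasing order, each edge goes
  on top of the shorter of the columns of its two endpoints. Whoever traverses the edge in the
  \<open>i\<close>-th cell of a column finds, at either endpoint, only larger edges in the cells below \<open>i\<close>, so
  walks descending through the table are increasing, and some column has height at least \<open>d/2\<close>.

  Let \<open>X\<close> be the path built so far, with \<open>|X| \<le> k\<close>. The set of vertices reachable from its end
  while avoiding \<open>X\<close> cannot double after each of more than \<open>lg n\<close> blocks of \<open>q\<close> rows. In a block
  where it does not double, the at least \<open>q - k\<close> edges per reached column that avoid \<open>X\<close> lie
  within fewer than twice as many vertices. A second table, of these edges alone, therefore has a
  column higher than \<open>(q - k)/2\<close>, and following it greedily from a reached vertex gives \<open>m\<close> further
  moves if \<open>q\<close> is about \<open>k + m\<^sup>2\<close>. The bound follows with \<open>m = \<lceil>s / (11 lg n)\<rceil>\<close>: as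
  \<open>k\<close> is at most about \<open>n/(4s) = (s / (11 lg n))\<^sup>2 / 4\<close>, each move then costs at most \<open>s\<close> rows.
\<close>

subsection \<open>Increasing paths\<close>

lemma path_edges_simps [simp]:
  "path_edges [] = []" "path_edges [x] = []"
  "path_edges (x # y # zs) = {x, y} # path_edges (y # zs)"
  by (simp_all add: path_edges_def)

lemma path_edges_snoc:
  "xs \<noteq> [] \<Longrightarrow> path_edges (xs @ [w]) = path_edges xs @ [{last xs, w}]"
  by (induction xs rule: induct_list012) auto

lemma path_edges_take: "path_edges (take (Suc k) xs) = take k (path_edges xs)"
proof (induction xs arbitrary: k rule: induct_list012)
  case (3 x y zs)
  then show ?case by (cases k) auto
qed auto

text \<open>The ordering enters as a numeric rank \<open>g\<close>. Confining the vertices to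
  \<open>\<Union>E\<close> makes \<open>card (\<Union>E)\<close> a bound for every set of reached
  endpoints.\<close>

definition inc_path :: "'a set set \<Rightarrow> ('a set \<Rightarrow> nat) \<Rightarrow> 'a list \<Rightarrow> bool" where
  "inc_path E g xs \<longleftrightarrow> xs \<noteq> [] \<and> distinct xs \<and> set xs \<subseteq> \<Union>E \<and> set (path_edges xs) \<subseteq> E
     \<and> sorted_wrt (\<lambda>e e'. g e < g e') (path_edges xs)"

lemma inc_path_take:
  assumes "inc_path E g xs"
  shows "inc_path E g (take (Suc k) xs)"
proof -
  have "xs \<noteq> []" using assms by (simp add: inc_path_def)
  moreover have "sorted_wrt (\<lambda>e e'. g e < g e') (take k (path_edges xs))"
    using assms by (simp add: inc_path_def sorted_wrt_take)
  ultimately show ?thesis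
    using assms set_take_subset[of "Suc k" xs] set_take_subset[of k "path_edges xs"]
    by (auto simp: inc_path_def path_edges_take)
qed

lemma inc_path_snoc:
  assumes "inc_path E g xs" "{last xs, w} \<in> E" "w \<notin> set xs"
    and "\<forall>e\<in>set (path_edges xs). g e < g {last xs, w}"
  shows "inc_path E g (xs @ [w])"
  using assms unfolding inc_path_def
  by (auto simp: path_edges_snoc sorted_wrt_append)

subsection \<open>Height tables\<close>

text \<open>Row 0 is the bottom row, and each edge fills exactly one cell. The rule "put the edge on
  the shorter column" survives only as \<open>descend\<close>, which speaks of both endpoints of the
  edge, not just of the column that holds it.\<close>

locale height_table =
  fixes E :: "'a set set" and g :: "'a set \<Rightarrow> nat" and h :: "'a \<Rightarrow> nat"
    and c :: "'a \<Rightarrow> nat \<Rightarrow> 'a set"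
  assumes cell_in: "i < h v \<Longrightarrow> c v i \<in> E"
    and cell_mem: "i < h v \<Longrightarrow> v \<in> c v i"
    and cell_inj: "i < h v \<Longrightarrow> j < h w \<Longrightarrow> c v i = c w j \<Longrightarrow> v = w \<and> i = j"
    and cell_surj: "e \<in> E \<Longrightarrow> \<exists>v i. i < h v \<and> e = c v i"
    and descend: "i < h v \<Longrightarrow> x \<in> c v i \<Longrightarrow> j < i \<Longrightarrow> j < h x \<and> g (c v i) < g (c x j)"

text \<open>The minus sign in the ranking makes the induction insert edges in decreasing order of
  \<open>g\<close>. A new edge is thus smaller than all present ones, and both columns
  \<open>u\<close> and \<open>v\<close> already reach up to row \<open>h u\<close>, where it is
  placed.\<close>

lemma height_table_exists:
  fixes E :: "'a set set" and g :: "'a set \<Rightarrow> nat"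
  assumes "finite E" "inj_on g E" "\<forall>e\<in>E. card e = 2"
  shows "\<exists>h c. height_table E g h c"
  using assms
proof (induction E rule: finite_ranking_induct[where f = "\<lambda>e. - int (g e)"])
  case empty
  show ?case by (rule exI[of _ "\<lambda>_. 0"], rule exI) (unfold_locales, auto)
next
  case (insert e S)
  show ?case
  proof (cases "e \<in> S")
    case True
    then show ?thesis using insert by (simp add: insert_absorb)
  next
    case False
    obtain h c where "height_table S g h c" using insert by auto
    then interpret height_table S g h c .
    have min: "g e < g f" if "f \<in> S" for f
    proof -
      have "g e \<noteq> g f" using insert.prems(1) that False by (auto simp: inj_on_def)
      then show ?thesis using insert.hyps(2)[OF that] by simp
    qed
    obtain a b where ab: "e = {a, b}" "a \<noteq> b"
      using insert.prems(2) by (auto simp: card_2_iff)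
    obtain u v where uv: "e = {u, v}" "u \<noteq> v" "h u \<le> h v"
    proof (cases "h a \<le> h b")
      case True
      with ab that[of a b] show ?thesis by blast
    next
      case False
      with ab that[of b a] show ?thesis by auto
    qed
    define h' where "h' = h(u := Suc (h u))"
    define c' where "c' = c(u := (c u)(h u := e))"
    have old: "c' x i = c x i" "i < h' x" if "i < h x" for x i
      using that by (auto simp: h'_def c'_def)
    have new: "c' u (h u) = e" "h u < h' u" by (auto simp: h'_def c'_def)
    have cases: "i < h x \<or> x = u \<and> i = h u" if "i < h' x" for x i
      using that by (auto simp: h'_def less_Suc_eq split: if_splits)
    have "height_table (insert e S) g h' c'"
    proof
      fix i x assume i: "i < h' x"
      show "c' x i \<in> insert e S" using cases[OF i] old cell_in new by auto
      show "x \<in> c' x i" using cases[OF i] old cell_mem new uv by auto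
      fix j
      { fix y assume j: "j < h' y" "c' x i = c' y j"
        show "x = y \<and> i = j"
          using cases[OF i] cases[OF j(1)] j(2) old new cell_inj cell_in False by metis }
      { fix y assume j: "y \<in> c' x i" "j < i"
        show "j < h' y \<and> g (c' x i) < g (c' y j)"
          using cases[OF i]
        proof
          assume "i < h x"
          then show ?thesis using descend[of i x y j] j old by auto
        next
          assume xi: "x = u \<and> i = h u"
          then have "j < h y" using j uv new by auto
          then show ?thesis using xi old new min[OF cell_in] by simp
        qed }
    next
      fix f assume "f \<in> insert e S"
      then show "\<exists>x i. i < h' x \<and> f = c' x i"
        using new old cell_surj by (metis insert_iff)
    qed
    then show ?thesis by blast
  qed
qed

text \<open>The invariant of the walk: \<open>r\<close> is the remaining supply of rows, and any of
  the edges there may come next unless it leads back to the path.\<close>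

definition ready :: "('a set \<Rightarrow> nat) \<Rightarrow> ('a \<Rightarrow> nat) \<Rightarrow> ('a \<Rightarrow> nat \<Rightarrow> 'a set) \<Rightarrow> 'a list \<Rightarrow> nat \<Rightarrow> bool"
  where "ready g h c xs r \<longleftrightarrow>
    r \<le> h (last xs) \<and> (\<forall>i<r. \<forall>e\<in>set (path_edges xs). g e < g (c (last xs) i))"

lemma ready_mono: "ready g h c xs r \<Longrightarrow> r' \<le> r \<Longrightarrow> ready g h c xs r'"
  by (auto simp: ready_def)

context height_table
begin

text \<open>Every edge fills a cell in a column over \<open>W\<close>, so the heights over
  \<open>W\<close> sum to at least \<open>card E\<close>, and the tallest column is at least the
  average.\<close>

lemma tall_column:
  assumes "finite E" "finite W" "\<Union>E \<subseteq> W" "E \<noteq> {}"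
  obtains v where "v \<in> W" "card E \<le> h v * card W"
proof -
  have W: "W \<noteq> {}"
    using assms(3,4) cell_surj cell_mem cell_in by blast
  have "E \<subseteq> (\<lambda>(v, i). c v i) ` (SIGMA v:W. {..<h v})"
  proof
    fix e assume e: "e \<in> E"
    then obtain v i where "i < h v" "e = c v i" using cell_surj by blast
    moreover from this e have "v \<in> W" using cell_mem assms(3) by blast
    ultimately show "e \<in> (\<lambda>(v, i). c v i) ` (SIGMA v:W. {..<h v})" by force
  qed
  then have "card E \<le> card (SIGMA v:W. {..<h v})"
    by (meson assms(2) finite_SigmaI finite_lessThan surj_card_le)
  then have *: "card E \<le> (\<Sum>v\<in>W. h v)" using assms(2) by simp
  have "\<exists>v\<in>W. card E \<le> h v * card W"
  proof -
    have "Max (h ` W) \<in> h ` W" using W assms(2) by simp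
    then obtain v where v: "v \<in> W" "h v = Max (h ` W)" by auto
    have "(\<Sum>v\<in>W. h v) \<le> card W * h v"
      using sum_bounded_above[of W h "h v"] v assms(2) by simp
    then have "card E \<le> h v * card W" using * by (simp add: mult.commute)
    then show ?thesis using v(1) by blast
  qed
  then show ?thesis using that by blast
qed

text \<open>By \<open>descend\<close> it is irrelevant which endpoint's column holds the traversed
  edge: the cells below row \<open>i\<close> at \<open>w\<close> are larger than this edge, which is
  larger than all earlier ones.\<close>

lemma ready_snoc:
  assumes "inc_path E' g (xs @ [w])" "xs \<noteq> []" "{last xs, w} = c z i" "i < h z" "r \<le> i"
  shows "ready g h c (xs @ [w]) r"
proof -
  have d: "j < h w \<and> g {last xs, w} < g (c w j)" if "j < r" for j
    using descend[OF assms(4), of w j] assms(3,5) that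
    by (metis insertCI order_less_le_trans)
  have e: "\<forall>f\<in>set (path_edges (xs @ [w])). f = {last xs, w} \<or> g f < g {last xs, w}"
    using assms(1,2) by (auto simp: inc_path_def path_edges_snoc sorted_wrt_append)
  have "r \<le> h w"
    by (cases r) (use d in \<open>auto simp: Suc_le_eq\<close>)
  then show ?thesis using d e unfolding ready_def by fastforce
qed

lemma inc_path_cell:
  assumes "inc_path E' g xs" "E \<subseteq> E'" "ready g h c xs r" "i < r"
    "c (last xs) i = {last xs, w}" "w \<notin> set xs"
  shows "inc_path E' g (xs @ [w])" "ready g h c (xs @ [w]) i"
proof -
  have i: "i < h (last xs)" using assms(3,4) by (simp add: ready_def)
  show "inc_path E' g (xs @ [w])"
    using inc_path_snoc[OF assms(1) _ assms(6)] cell_in[of i "last xs"] assms(2-5) i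
    unfolding ready_def by (metis subsetD)
  then show "ready g h c (xs @ [w]) i"
    using ready_snoc[of E' xs w "last xs" i i] i assms(1,5) by (auto simp: inc_path_def)
qed

lemma cell_other:
  assumes "\<forall>e\<in>E. card e = 2" "i < h v"
  obtains w where "c v i = {v, w}" "w \<noteq> v"
proof -
  have "card (c v i) = 2" using assms cell_in by simp
  then obtain a b where ab: "c v i = {a, b}" "a \<noteq> b" unfolding card_2_iff by blast
  moreover have "v = a \<or> v = b" using cell_mem[OF assms(2)] ab by simp
  ultimately show ?thesis using that[of a] that[of b] by (auto simp: insert_commute)
qed

text \<open>Distinct cells of a column hold distinct edges, hence lead to distinct neighbours.
  Avoiding \<open>X\<close> therefore costs at most \<open>card X\<close> rows.\<close>

lemma cells_into_le:
  assumes "finite X" "I \<subseteq> {..<h v}"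
  shows "card {i \<in> I. \<exists>w\<in>X. c v i = {v, w}} \<le> card X"
proof -
  let ?J = "{i \<in> I. \<exists>w\<in>X. c v i = {v, w}}"
  have "inj_on (c v) ?J" using cell_inj assms(2) unfolding inj_on_def by blast
  moreover have "c v ` ?J \<subseteq> (\<lambda>w. {v, w}) ` X" by auto
  ultimately have "card ?J \<le> card ((\<lambda>w. {v, w}) ` X)"
    using assms(1) by (meson card_inj_on_le finite_imageI)
  then show ?thesis using card_image_le[OF assms(1)] le_trans by blast
qed


section \<open>Endpoints reachable within a range of rows\<close>

text \<open>Here \<open>c\<close> is the table, \<open>r\<close> the row from which \<open>xs\<close> is continued, and the last argument the
  row reached.\<close>

inductive reach :: "'a list \<Rightarrow> nat \<Rightarrow> 'a list \<Rightarrow> nat \<Rightarrow> bool" for xs r where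
  start: "reach xs r xs r"
| step: "reach xs r ys a \<Longrightarrow> i < a \<Longrightarrow> c (last ys) i = {last ys, w} \<Longrightarrow> w \<notin> set ys
    \<Longrightarrow> reach xs r (ys @ [w]) i"

lemma reach_path:
  assumes "reach xs r ys a" "inc_path E g xs" "ready g h c xs r"
  shows "inc_path E g ys \<and> ready g h c ys a \<and> (\<exists>zs. ys = xs @ zs)"
  using assms
proof (induction rule: reach.induct)
  case (step ys a i w)
  then show ?case using inc_path_cell[of E ys a i w] by auto
qed simp

text \<open>Cutting the walk off at \<open>x\<close> leaves a walk that has descended no further
  than the whole one.\<close>

lemma reach_vertex:
  assumes "reach xs r ys a" "x \<in> set ys"
  shows "x \<in> set xs \<or> (\<exists>ys' a'. a \<le> a' \<and> reach xs r ys' a' \<and> last ys' = x)"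
  using assms
proof (induction rule: reach.induct)
  case (step ys a i w)
  show ?case
  proof (cases "x = w")
    case True
    then show ?thesis using reach.step[OF step.hyps] by (metis last_snoc order_refl)
  next
    case False
    then have "x \<in> set ys" using step.prems by simp
    then show ?thesis using step.IH step.hyps(2) by (meson less_imp_le order_trans)
  qed
qed simp

text \<open>Walks may stop above row \<open>a\<close>, so lowering \<open>a\<close> only enlarges
  the set; this is what makes its growth from block to block measurable.\<close>

definition ends :: "'a list \<Rightarrow> nat \<Rightarrow> nat \<Rightarrow> 'a set" where
  "ends xs r a = {last ys | ys b. reach xs r ys b \<and> a \<le> b}"

lemma ends_mono: "b \<le> a \<Longrightarrow> ends xs r a \<subseteq> ends xs r b"
  unfolding ends_def by (blast intro: order_trans)

text \<open>Only \<open>xs\<close> has to be avoided: if \<open>w\<close> was already met after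
  \<open>xs\<close>, the walk cut off at \<open>w\<close> reaches it with no fewer rows
  left.\<close>

lemma ends_step:
  assumes "z \<in> ends xs r a" "i < a" "b \<le> i" "c z i = {z, w}" "w \<notin> set xs"
  shows "w \<in> ends xs r b"
proof -
  obtain ys a' where ys: "reach xs r ys a'" "a \<le> a'" "z = last ys"
    using assms(1) by (auto simp: ends_def)
  show ?thesis
  proof (cases "w \<in> set ys")
    case True
    with reach_vertex[OF ys(1)] assms(5) obtain ys' b' where
      "a' \<le> b'" "reach xs r ys' b'" "last ys' = w" by blast
    moreover have "b \<le> b'" using calculation(1) ys(2) assms(2,3) by linarith
    ultimately show ?thesis unfolding ends_def by blast
  next
    case False
    then have "reach xs r (ys @ [w]) i"
      using reach.step[OF ys(1), of i w] ys assms by simp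
    then show ?thesis using assms(3) unfolding ends_def by (metis (mono_tags, lifting) last_snoc mem_Collect_eq)
  qed
qed

lemma ends_subset:
  assumes "inc_path E g xs" "ready g h c xs r"
  shows "ends xs r a \<subseteq> \<Union>E"
proof
  fix z assume "z \<in> ends xs r a"
  then obtain ys b where "reach xs r ys b" "z = last ys" by (auto simp: ends_def)
  then have "inc_path E g ys" using reach_path assms by blast
  then show "z \<in> \<Union>E" using \<open>z = last ys\<close> last_in_set unfolding inc_path_def by blast
qed

lemma ends_path:
  assumes "z \<in> ends xs r a" "inc_path E g xs" "ready g h c xs r"
  obtains zs where "inc_path E g (xs @ zs)" "ready g h c (xs @ zs) a" "last (xs @ zs) = z"
proof -
  obtain ys b where "reach xs r ys b" "a \<le> b" "z = last ys"
    using assms(1) by (auto simp: ends_def)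
  then show ?thesis using that reach_path[of xs r ys b] assms ready_mono[of g h c ys b a] by blast
qed

end

section \<open>Extending a path within one block of rows\<close>

text \<open>With \<open>y\<close> new vertices on the path, the next move has to avoid at most \<open>y\<close> vertices (the
  other new ones and the old end), so it uses up at most \<open>y + 1\<close> rows of the second table. This is
  the bookkeeping in the last assumption.\<close>

lemma two_table_greedy:
  assumes "height_table E g h c" "height_table F g h' c'" "F \<subseteq> E" "\<forall>e\<in>F. card e = 2"
    and FE: "\<forall>e\<in>F. \<exists>z i. r \<le> i \<and> i < h z \<and> e = c z i"
    and FX: "\<forall>e\<in>F. e \<inter> set xs \<subseteq> {last xs}" and "xs \<noteq> []"
    and "inc_path E g (xs @ zs)" "ready g h c (xs @ zs) r" "ready g h' c' (xs @ zs) p"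
    and "m * (m + 1) \<le> 2 * p + length zs * (length zs + 1)"
  shows "\<exists>zs. m \<le> length zs \<and> inc_path E g (xs @ zs) \<and> ready g h c (xs @ zs) r"
  using assms(8-)
proof (induction "m - length zs" arbitrary: zs p)
  case 0
  then show ?case by auto
next
  case (Suc d)
  interpret E: height_table E g h c by fact
  interpret F: height_table F g h' c' by fact
  define y where "y = length zs"
  define z where "z = last (xs @ zs)"
  have ym: "y + 1 \<le> m" using Suc.hyps(2) by (simp add: y_def)
  have "(y + 1) * (y + 2) \<le> m * (m + 1)"
    using ym by (intro mult_mono) auto
  then have p: "y + 1 \<le> p" using Suc.prems(4) by (simp add: y_def)
  let ?B = "set zs \<union> {last xs} - {z}"
  have "z \<in> set zs \<union> {last xs}" by (cases "zs = []") (auto simp: z_def)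
  moreover have "card (set zs \<union> {last xs}) \<le> Suc y"
    using card_length[of zs] card_Un_le[of "set zs" "{last xs}"] by (simp add: y_def)
  ultimately have B: "card ?B \<le> y" by simp
  have ph: "p \<le> h' z" using Suc.prems(3) by (simp add: ready_def z_def)
  \<comment> \<open>A window of \<open>y + 1\<close> rows cannot consist entirely of the at most
    \<open>y\<close> rows leading into \<open>?B\<close>.\<close>
  let ?I = "{p - (y + 1)..<p}"
  have "card {i \<in> ?I. \<exists>w\<in>?B. c' z i = {z, w}} \<le> y"
  proof (rule order_trans[OF F.cells_into_le B])
    show "?I \<subseteq> {..<h' z}" using ph by auto
  qed simp
  moreover have "card ?I = y + 1" using p by simp
  ultimately have "{i \<in> ?I. \<exists>w\<in>?B. c' z i = {z, w}} \<noteq> ?I" by (metis Suc_eq_plus1 not_less_eq_eq order_refl)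
  then have "\<exists>i\<in>?I. \<not> (\<exists>w\<in>?B. c' z i = {z, w})" by blast
  then obtain i where "i \<in> ?I" and iB: "\<not> (\<exists>w\<in>?B. c' z i = {z, w})" by blast
  then have i: "p - (y + 1) \<le> i" "i < p" by simp_all
  obtain w where w: "c' z i = {z, w}" "w \<noteq> z"
    using F.cell_other[OF assms(4), of i z] i ph by auto
  have wF: "{z, w} \<in> F" using F.cell_in[of i z] i ph w by simp
  have "w \<notin> set zs" "w \<noteq> last xs" using iB w by blast+
  moreover have "w \<in> set xs \<Longrightarrow> w = last xs" using FX wF by blast
  ultimately have new: "w \<notin> set (xs @ zs)" by auto
  have path: "inc_path E g (xs @ zs @ [w])" "ready g h' c' (xs @ zs @ [w]) i"
    using F.inc_path_cell[OF Suc.prems(1) assms(3) Suc.prems(3) i(2)] w new z_def by auto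
  \<comment> \<open>The edge chosen in the second table also has a cell of the first table in some
    row \<open>j \<ge> r\<close>, so the supply \<open>r\<close> there is not consumed.\<close>
  obtain u j where u: "r \<le> j" "j < h u" "{z, w} = c u j" using FE wF by blast
  have "ready g h c (xs @ zs @ [w]) r"
    using E.ready_snoc[of E "xs @ zs" w u j r] path(1) u assms(7) z_def by simp
  moreover have "m * (m + 1) \<le> 2 * i + length (zs @ [w]) * (length (zs @ [w]) + 1)"
  proof -
    have "2 * p \<le> 2 * i + 2 * (y + 1)" using i(1) by simp
    then show ?thesis using Suc.prems(4) by (simp add: y_def)
  qed
  moreover have "d = m - length (zs @ [w])" using Suc.hyps(2) by simp
  ultimately show ?case using Suc.hyps(1)[of "zs @ [w]" i] path by simp
qed


text \<open>An edge of \<open>F\<close> is itself a legal further move from a vertex of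
  \<open>?R\<close> within the block, so both its endpoints lie in \<open>?R'\<close>. Comparing
  \<open>card F\<close> with the size of \<open>?R'\<close> yields the high column of the second
  table.\<close>

lemma (in height_table) stage:
  assumes "finite E" "\<forall>e\<in>E. card e = 2" "inj_on g E" "inc_path E g xs" "ready g h c xs r"
    and small: "card (ends xs r b) < 2 * card (ends xs r (b + q))"
    and q: "length xs + m * (m + 1) + 1 \<le> q"
  shows "\<exists>zs. m \<le> length zs \<and> inc_path E g (xs @ zs) \<and> ready g h c (xs @ zs) b"
proof -
  let ?R = "ends xs r (b + q)" and ?R' = "ends xs r b"
  let ?I = "{b..<b + q}"
  define A where "A z = {i \<in> ?I. \<forall>w\<in>set xs. c z i \<noteq> {z, w}}" for z
  define F where "F = (\<lambda>(z, i). c z i) ` (SIGMA z:?R. A z)"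
  have xs: "xs \<noteq> []" "distinct xs" using assms(4) by (auto simp: inc_path_def)
  have "finite (\<Union>E)" using assms(1,2) by (intro finite_Union) (auto intro: card_ge_0_finite)
  then have fin: "finite ?R" "finite ?R'"
    using ends_subset[OF assms(4,5)] finite_subset by blast+
  have "?R \<subseteq> ?R'" by (rule ends_mono) simp
  have height: "b + q \<le> h z" if "z \<in> ?R" for z
    using ends_path[OF that assms(4,5)] by (metis ready_def)
  have A: "q - length xs \<le> card (A z)" if "z \<in> ?R" for z
  proof -
    have "card {i \<in> ?I. \<exists>w\<in>set xs. c z i = {z, w}} \<le> length xs"
      using height[OF that] by (intro order_trans[OF cells_into_le card_length]) auto
    moreover have "A z = ?I - {i \<in> ?I. \<exists>w\<in>set xs. c z i = {z, w}}" by (auto simp: A_def)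
    then have "card (A z) = card ?I - card {i \<in> ?I. \<exists>w\<in>set xs. c z i = {z, w}}"
      by (simp only:) (intro card_Diff_subset, auto)
    ultimately show ?thesis by simp
  qed
  have F_cell: "\<exists>z i. z \<in> ?R \<and> i \<in> A z \<and> b \<le> i \<and> i < b + q \<and> i < h z \<and> e = c z i" if e: "e \<in> F" for e
  proof -
    obtain z i where zi: "z \<in> ?R" "i \<in> A z" "e = c z i" using e by (auto simp: F_def)
    then have "b \<le> i" "i < b + q" by (auto simp: A_def)
    then show ?thesis using zi height[OF zi(1)]
      by (intro exI[of _ z] exI[of _ i]) simp
  qed
  have FE: "F \<subseteq> E" using F_cell cell_in by blast
  then have F_fin: "finite F" and F2: "\<forall>e\<in>F. card e = 2" and Fg: "inj_on g F"
    using assms(1-3) finite_subset inj_on_subset by blast+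
  have F_out: "w \<notin> set xs" "w \<in> ?R'" if "z \<in> ?R" "i \<in> A z" "c z i = {z, w}" for z i w
  proof -
    show "w \<notin> set xs" using that by (auto simp: A_def)
    then show "w \<in> ?R'" using ends_step[OF that(1), of i b w] that by (auto simp: A_def)
  qed
  have FR: "\<Union>F \<subseteq> ?R'"
  proof clarify
    fix x e assume x: "x \<in> e" "e \<in> F"
    then obtain z i where z: "z \<in> ?R" "i \<in> A z" "i < h z" "e = c z i" using F_cell by blast
    obtain w where w: "c z i = {z, w}" using cell_other[OF assms(2) z(3)] by blast
    then show "x \<in> ?R'" using x z F_out(2)[OF z(1,2) w] \<open>?R \<subseteq> ?R'\<close> by auto
  qed
  \<comment> \<open>A walk continuing \<open>xs\<close> ends on \<open>xs\<close> only if nothing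
    was added, so \<open>z\<close> can meet \<open>xs\<close> only in its end; \<open>w\<close> is
    off \<open>xs\<close> by the choice of \<open>A z\<close>.\<close>
  have FX: "e \<inter> set xs \<subseteq> {last xs}" if e: "e \<in> F" for e
  proof -
    obtain z i where z: "z \<in> ?R" "i \<in> A z" "i < h z" "e = c z i" using F_cell[OF e] by blast
    obtain w where w: "c z i = {z, w}" using cell_other[OF assms(2) z(3)] by blast
    obtain zs where zs: "inc_path E g (xs @ zs)" "last (xs @ zs) = z"
      using ends_path[OF z(1) assms(4,5)] by metis
    have "z \<in> set xs \<Longrightarrow> z = last xs"
      using zs by (cases "zs = []") (auto simp: inc_path_def)
    then show ?thesis using F_out(1)[OF z(1,2) w] w z by auto
  qed
  have "card F = card (SIGMA z:?R. A z)"
    unfolding F_def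
  proof (rule card_image, rule inj_onI, clarify)
    fix z i z' i' assume "z \<in> ?R" "i \<in> A z" "z' \<in> ?R" "i' \<in> A z'" and eq: "c z i = c z' i'"
    then have "i < h z" "i' < h z'" using height[of z] height[of z'] by (auto simp: A_def)
    then show "z = z' \<and> i = i'" using cell_inj eq by blast
  qed
  also have "\<dots> = (\<Sum>z\<in>?R. card (A z))" using fin(1) by (simp add: A_def)
  also have "\<dots> \<ge> card ?R * (q - length xs)" using sum_bounded_below[of ?R "q - length xs"] A by simp
  finally have cF: "card ?R * (q - length xs) \<le> card F" .
  have "0 < card ?R" using small by simp
  then have "0 < card ?R * (q - length xs)" using q by simp
  then have "0 < card F" using cF by linarith
  then have "F \<noteq> {}" by auto
  obtain h' c' where "height_table F g h' c'" using height_table_exists[OF F_fin Fg F2] by blast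
  then interpret F: height_table F g h' c' .
  obtain v where v: "card F \<le> h' v * card ?R'"
    using F.tall_column[OF F_fin fin(2) FR \<open>F \<noteq> {}\<close>] by blast
  have "card ?R * (q - length xs) \<le> h' v * card ?R'" using cF v by linarith
  also have "\<dots> \<le> h' v * (2 * card ?R - 1)" using small by (intro mult_left_mono) auto
  finally have le: "card ?R * (q - length xs) \<le> h' v * (2 * card ?R - 1)" .
  have hv: "0 < h' v" using v \<open>0 < card F\<close> by (auto intro: gr0I)
  have "h' v * (2 * card ?R - 1) < h' v * (2 * card ?R)"
    using hv \<open>0 < card ?R\<close> by (intro mult_strict_left_mono) auto
  from le_less_trans[OF le this] have "card ?R * (q - length xs) < card ?R * (2 * h' v)"
    by (simp only: ac_simps)
  then have p2: "q - length xs < 2 * h' v" by simp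
  \<comment> \<open>The top cell of the high column serves only to locate a starting point, which
    leaves \<open>p\<close> rows below it. The \<open>+ 1\<close> in the bound on \<open>q\<close>
    and the strictness of \<open>p2\<close> pay for this.\<close>
  define p where "p = h' v - 1"
  have "even (m * (m + 1))" by simp
  then have p: "m * (m + 1) \<le> 2 * p" using p2 q hv unfolding p_def by presburger
  have pv: "p < h' v" using hv by (simp add: p_def)
  \<comment> \<open>The top edge \<open>e\<close> of the high column need not start at the reached endpoint \<open>z\<close>, nor does its
    cell in the first table have to be in the column of \<open>v\<close>; but at \<open>z\<close> the \<open>p\<close> lowest cells of
    the second table exceed \<open>e\<close>, which itself exceeds all edges of the path to \<open>z\<close>.\<close>
  define e where "e = c' v p"
  have "e \<in> F" unfolding e_def using F.cell_in pv by blast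
  then obtain z i where z: "z \<in> ?R" "i \<in> A z" "b \<le> i" "i < b + q" "i < h z" "e = c z i"
    using F_cell by blast
  obtain zs where zs: "inc_path E g (xs @ zs)" "ready g h c (xs @ zs) (b + q)" "last (xs @ zs) = z"
    using ends_path[OF z(1) assms(4,5)] by metis
  have "z \<in> c' v p" using cell_mem z e_def by metis
  then have D: "j < h' z \<and> g e < g (c' z j)" if "j < p" for j
    using F.descend[OF pv _ that] by (simp add: e_def)
  have old: "\<forall>f\<in>set (path_edges (xs @ zs)). g f < g e"
    using zs z by (auto simp: ready_def)
  have "p \<le> h' z" by (cases p) (use D in \<open>auto simp: Suc_le_eq\<close>)
  then have "ready g h' c' (xs @ zs) p"
    using D old zs(3) unfolding ready_def by fastforce
  moreover have "ready g h c (xs @ zs) b" using zs(2) ready_mono by (metis le_add1)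
  moreover have "\<forall>e\<in>F. \<exists>z i. b \<le> i \<and> i < h z \<and> e = c z i" using F_cell by blast
  ultimately show ?thesis
    using two_table_greedy[OF height_table_axioms F.height_table_axioms FE F2 _ _ xs(1) zs(1)] FX p
    by fastforce
qed

text \<open>The set of reached endpoints starts with at least one element. Doubling in all
  \<open>L\<close> blocks would give \<open>2 ^ L\<close> vertices, more than
  \<open>\<Union>E\<close> has, so \<open>stage\<close> applies to some block; rows below that block
  are given up as needed.\<close>

lemma (in height_table) group:
  assumes "finite E" "\<forall>e\<in>E. card e = 2" "inj_on g E" "inc_path E g xs" "ready g h c xs r"
    and "card (\<Union>E) < 2 ^ L" "L * q \<le> r" "length xs + m * (m + 1) + 1 \<le> q"
  shows "\<exists>zs. m \<le> length zs \<and> inc_path E g (xs @ zs) \<and> ready g h c (xs @ zs) (r - L * q)"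
proof -
  have fin: "finite (\<Union>E)" using assms(1,2) by (intro finite_Union) (auto intro: card_ge_0_finite)
  have "\<exists>j<L. card (ends xs r (r - Suc j * q)) < 2 * card (ends xs r (r - j * q))"
  proof (rule ccontr)
    assume *: "\<not> ?thesis"
    have "2 ^ j \<le> card (ends xs r (r - j * q))" if "j \<le> L" for j
      using that
    proof (induction j)
      case 0
      have "last xs \<in> ends xs r r" unfolding ends_def using reach.start by blast
      moreover have "finite (ends xs r r)"
        using ends_subset[OF assms(4,5)] fin finite_subset by blast
      ultimately show ?case by (auto simp: Suc_le_eq card_gt_0_iff)
    next
      case (Suc j)
      then have "2 * card (ends xs r (r - j * q)) \<le> card (ends xs r (r - Suc j * q))"
        using * by (meson Suc_le_lessD not_less)
      then show ?case using Suc by simp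
    qed
    from this[of L] have "2 ^ L \<le> card (\<Union>E)"
      using card_mono[OF fin ends_subset[OF assms(4,5), of "r - L * q"]] by simp
    then show False using assms(6) by simp
  qed
  then obtain j where j: "j < L" "card (ends xs r (r - Suc j * q)) < 2 * card (ends xs r (r - j * q))"
    by blast
  \<comment> \<open>This keeps the natural-number subtractions exact: block \<open>j\<close> lies
    entirely above row 0.\<close>
  have jL: "Suc j * q \<le> L * q" using j(1) by (intro mult_right_mono) auto
  then have "r - j * q = r - Suc j * q + q" using assms(7) by simp
  then show ?thesis
    using stage[OF assms(1-5), of "r - Suc j * q" q m] j(2) assms(8) ready_mono jL
    by (metis diff_le_mono2)
qed

text \<open>Each of \<open>N\<close> groups spends \<open>L * q\<close> rows and adds at least
  \<open>m\<close> vertices. The alternative \<open>k < length xs\<close> ends the process early,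
  since \<open>q\<close> leaves room to avoid at most \<open>k\<close> old vertices.\<close>

lemma (in height_table) long_path:
  assumes "finite E" "\<forall>e\<in>E. card e = 2" "inj_on g E"
    and "card (\<Union>E) < 2 ^ L" "k + m * (m + 1) + 1 \<le> q" "0 < h v" "N * (L * q) \<le> h v" "k \<le> N * m"
  shows "\<exists>xs. inc_path E g xs \<and> k < length xs"
proof -
  have "\<exists>xs. inc_path E g xs \<and> (k < length xs \<or> i * m < length xs \<and> ready g h c xs (h v - i * (L * q)))"
    if "i \<le> N" for i
    using that
  proof (induction i)
    case 0
    have "v \<in> \<Union>E" using cell_in cell_mem assms(6) by blast
    then show ?case by (intro exI[of _ "[v]"]) (auto simp: inc_path_def ready_def)
  next
    case (Suc i)
    then obtain xs where xs: "inc_path E g xs"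
      "k < length xs \<or> i * m < length xs \<and> ready g h c xs (h v - i * (L * q))" by auto
    show ?case
    proof (cases "k < length xs")
      case True
      then show ?thesis using xs by blast
    next
      case False
      have "Suc i * (L * q) \<le> N * (L * q)" using Suc.prems by (intro mult_right_mono) auto
      then have "L * q \<le> h v - i * (L * q)" using assms(7) by simp
      moreover have ready: "ready g h c xs (h v - i * (L * q))" "i * m < length xs"
        using xs(2) False by auto
      moreover have "length xs + m * (m + 1) + 1 \<le> q" using False assms(5) by linarith
      ultimately obtain zs where zs: "m \<le> length zs" "inc_path E g (xs @ zs)"
        "ready g h c (xs @ zs) (h v - i * (L * q) - L * q)"
        using group[OF assms(1-3) xs(1) _ assms(4)] by blast
      then have "Suc i * m < length (xs @ zs)" using ready(2) by simp
      moreover have "h v - i * (L * q) - L * q = h v - Suc i * (L * q)" by simp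
      ultimately show ?thesis using zs by metis
    qed
  qed
  from this[of N] show ?thesis using assms(8) by (auto intro: le_less_trans)
qed


subsection \<open>The altitude\<close>

text \<open>The rank of an edge is the number of edges up to and including it.\<close>

lemma rank_of_linear_order:
  assumes "finite E" "linear_order_on E r"
  obtains g :: "'b \<Rightarrow> nat" where "inj_on g E"
    "\<And>e e'. e \<in> E \<Longrightarrow> e' \<in> E \<Longrightarrow> g e < g e' \<Longrightarrow> (e, e') \<in> r \<and> e \<noteq> e'"
proof -
  define g where "g e = card {f \<in> E. (f, e) \<in> r}" for e
  have r: "refl_on E r" "trans r" "antisym r" "total_on E r"
    using assms(2) by (auto simp: order_on_defs)
  have less: "g e < g e'" if "e \<in> E" "e' \<in> E" "(e, e') \<in> r" "e \<noteq> e'" for e e'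
  proof -
    have "(e', e) \<notin> r" using r(3) that by (meson antisymD)
    then have "{f \<in> E. (f, e) \<in> r} \<subset> {f \<in> E. (f, e') \<in> r}"
      using r(1,2) that by (auto simp: refl_on_def dest: transD)
    then show ?thesis unfolding g_def using assms(1) by (intro psubset_card_mono) auto
  qed
  have "inj_on g E"
    using less r(4) by (auto simp: inj_on_def total_on_def) (metis less_irrefl)
  moreover have "(e, e') \<in> r \<and> e \<noteq> e'" if "e \<in> E" "e' \<in> E" "g e < g e'" for e e'
    using less[of e' e] that r(4) unfolding total_on_def by (metis less_asym less_irrefl)
  ultimately show ?thesis using that by blast
qed

lemma altitude_ge:
  assumes "finite V"
    and "\<And>r. linear_order_on E r \<Longrightarrow> \<exists>xs. monotone_path V E r xs \<and> path_length xs = k"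
  shows "k \<le> altitude V E"
  unfolding altitude_def
proof (rule Greatest_le_nat[where b = "card V"])
  show "\<forall>r. linear_order_on E r \<longrightarrow> (\<exists>xs. monotone_path V E r xs \<and> path_length xs = k)"
    using assms(2) by blast
  fix l assume l: "\<forall>r. linear_order_on E r \<longrightarrow> (\<exists>xs. monotone_path V E r xs \<and> path_length xs = l)"
  \<comment> \<open>Some edge-ordering must be exhibited to turn the condition on \<open>l\<close>
    into an actual path, whose distinct vertices bound \<open>l\<close>.\<close>
  obtain r where "well_order_on E r" using well_order_on by blast
  then have "linear_order_on E r" by (simp add: well_order_on_def)
  then obtain xs where xs: "monotone_path V E r xs" "path_length xs = l" using l by blast
  then have "card (set xs) = length xs" "set xs \<subseteq> V"
    by (auto simp: monotone_path_def is_path_def distinct_card)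
  then have "length xs \<le> card V" using card_mono[OF assms(1)] by metis
  then show "l \<le> card V" using xs(2) by (simp add: path_length_def)
qed

section \<open>Edge counts and the choice of parameters\<close>

lemma handshake:
  assumes "simple_graph V E"
  shows "(\<Sum>v\<in>V. degree E v) = 2 * card E"
proof -
  have V: "finite V" "\<forall>e\<in>E. e \<subseteq> V \<and> card e = 2" using assms by (auto simp: simple_graph_def)
  then have E: "finite E" by (meson PowI finite_Pow_iff finite_subset subsetI)
  have "(\<Sum>v\<in>V. degree E v) = (\<Sum>v\<in>V. \<Sum>e\<in>E. if v \<in> e then 1 else 0)"
    using E by (simp add: degree_def sum.If_cases Int_def)
  also have "\<dots> = (\<Sum>e\<in>E. \<Sum>v\<in>V. if v \<in> e then 1 else 0)" by (rule sum.swap)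
  also have "\<dots> = (\<Sum>e\<in>E. 2)"
  proof (rule sum.cong[OF refl])
    fix e assume "e \<in> E"
    then have "{v \<in> V. v \<in> e} = e" "card e = 2" using V by auto
    then show "(\<Sum>v\<in>V. if v \<in> e then 1 else 0) = (2::nat)"
      using V(1) by (simp add: sum.If_cases Int_def)
  qed
  finally show ?thesis by simp
qed

lemma degree_le:
  assumes "simple_graph V E"
  shows "degree E v \<le> card V"
proof -
  have V: "finite V" using assms by (simp add: simple_graph_def)
  have "{e \<in> E. v \<in> e} \<subseteq> (\<lambda>w. {v, w}) ` V"
  proof
    fix e assume "e \<in> {e \<in> E. v \<in> e}"
    then have e: "v \<in> e" "e \<subseteq> V" "card e = 2" using assms by (auto simp: simple_graph_def)
    then obtain a b where "e = {a, b}" by (auto simp: card_2_iff)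
    then have "e = {v, a} \<or> e = {v, b}" "a \<in> V" "b \<in> V" using e by auto
    then show "e \<in> (\<lambda>w. {v, w}) ` V" by blast
  qed
  then show ?thesis unfolding degree_def using V by (meson surj_card_le)
qed

text \<open>With \<open>l = lg n\<close> and \<open>t = s / (11 * l)\<close>, the definition of
  \<open>s\<close> says \<open>n = s * t^2\<close>. Taking \<open>m\<close> about \<open>t\<close>
  makes \<open>q\<close> at most \<open>3 * t^2\<close> and \<open>L\<close> at most
  \<open>2 * l\<close>, so a group costs at most \<open>6 * l * t^2 \<le> s * t\<close> rows for
  \<open>m\<close> moves.\<close>

lemma parameters:
  fixes n H :: nat and s d :: real
  defines "K \<equiv> d / (4 * s) * (1 - 2 / d) * (1 - 1 / s) * (1 - 4 * s^2 / (d - 2))"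
  assumes s: "s = real n powr (1/3) * (11 * log 2 (real n)) powr (2/3)"
    and d: "2 < d" "d \<le> real n" "d \<le> 2 * real H" and "0 \<le> K"
  obtains L k m N q :: nat where "n < 2 ^ L" "k + m * (m + 1) + 1 \<le> q" "N * (L * q) \<le> H"
    "k \<le> N * m" "K < real k"
proof -
  define l where "l = log 2 (real n)"
  have "2 < real n" using d by linarith
  then have n: "3 \<le> real n" by simp
  have "log 2 2 < log 2 (real n)" using n by (subst log_less_cancel_iff) auto
  then have l: "1 < l" by (simp add: l_def)
  have s0: "0 < s" unfolding s l_def[symmetric] using n l by (intro mult_pos_pos) auto
  have "s ^ 3 = s powr 3" using s0 by (simp add: powr_numeral)
  also have "\<dots> = real n * (11 * l)\<^sup>2"
    using n l by (simp add: s powr_mult powr_powr powr_numeral flip: l_def)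
  finally have s3: "s ^ 3 = real n * (11 * l)\<^sup>2" .
  \<comment> \<open>The cube of \<open>s\<close> is at least \<open>3 * 11^2 = 363\<close>, which
    exceeds \<open>7^3 = 343\<close>.\<close>
  have "7 < s"
  proof (rule ccontr)
    assume "\<not> 7 < s"
    then have "s ^ 3 \<le> 7 ^ 3" using s0 by (intro power_mono) auto
    moreover have "3 * 11\<^sup>2 \<le> real n * (11 * l)\<^sup>2"
      using n l by (intro mult_mono power_mono) auto
    ultimately show False using s3 by simp
  qed
  have "K = (d - 2) * (s - 1) / (4 * s\<^sup>2) * (1 - 4 * s\<^sup>2 / (d - 2))"
    using s0 d(1) by (simp add: K_def field_simps power2_eq_square)
  moreover have "0 < (d - 2) * (s - 1) / (4 * s\<^sup>2)" using \<open>7 < s\<close> d(1) by simp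
  ultimately have "0 \<le> 1 - 4 * s\<^sup>2 / (d - 2)"
    using \<open>0 \<le> K\<close> by (meson mult_pos_neg not_less)
  then have ds: "4 * s\<^sup>2 \<le> d - 2" using d(1) by (simp add: field_simps)
  \<comment> \<open>Multiplied out, the last factor costs exactly \<open>s - 1\<close>, the
    allowance for rounding \<open>N\<close> down.\<close>
  have K: "K = (d - 2) * (s - 1) / (4 * s\<^sup>2) - (s - 1)"
  proof -
    have "(d - 2) * (s - 1) / (4 * s\<^sup>2) * (4 * s\<^sup>2 / (d - 2)) = s - 1" using d(1) s0 by simp
    then show ?thesis using \<open>K = _\<close> by (simp only: right_diff_distrib mult_1_right)
  qed
  have "(d - 2) * (s - 1) \<le> d * s" using d(1) \<open>7 < s\<close> by (intro mult_mono) auto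
  then have "(d - 2) * (s - 1) / (4 * s\<^sup>2) \<le> d * s / (4 * s\<^sup>2)" by (intro divide_right_mono) auto
  also have "\<dots> = d / (4 * s)" by (simp add: power2_eq_square)
  finally have Kd: "K \<le> d / (4 * s) - (s - 1)" using K by simp
  define t where "t = s / (11 * l)"
  have st: "s = 11 * l * t" using l by (simp add: t_def)
  have t0: "0 < t" using s0 l by (simp add: t_def)
  have "s * t\<^sup>2 * (11 * l)\<^sup>2 = real n * (11 * l)\<^sup>2"
    using s3 st by (simp add: power2_eq_square power3_eq_cube algebra_simps)
  then have nt: "real n = s * t\<^sup>2" using l by simp
  have "s * (4 * s) \<le> s * t\<^sup>2" using ds d nt by (simp add: power2_eq_square)
  then have "4 * s \<le> t\<^sup>2" using s0 by simp
  then have "4\<^sup>2 < t\<^sup>2" using \<open>7 < s\<close> by simp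
  then have t4: "4 < t" using power2_less_imp_less[of 4 t] t0 by simp
  define m where "m = nat \<lceil>t\<rceil>"
  define k where "k = nat \<lfloor>K\<rfloor> + 1"
  define q where "q = k + m * (m + 1) + 1"
  define L where "L = nat \<lfloor>l\<rfloor> + 1"
  define N where "N = H div (L * q)"
  have m: "t \<le> m" "m < t + 1" unfolding m_def using t0 by linarith+
  have k: "K < k" "k \<le> K + 1" unfolding k_def using \<open>0 \<le> K\<close> by linarith+
  have L: "l < L" "L \<le> l + 1" unfolding L_def using l by linarith+
  have "real n = 2 powr l" using n by (simp add: l_def)
  also have "\<dots> < 2 powr L" using L by simp
  also have "\<dots> = real (2 ^ L)" by (simp add: powr_realpow)
  finally have "n < 2 ^ L" by (simp only: of_nat_less_iff)
  have "K \<le> d / (4 * s)" using Kd \<open>7 < s\<close> by simp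
  also have "\<dots> \<le> real n / (4 * s)" using d s0 by (simp add: divide_right_mono)
  also have "\<dots> = t\<^sup>2 / 4" using nt s0 by simp
  finally have "K \<le> t\<^sup>2 / 4" .
  moreover have "real m * (m + 1) \<le> (t + 1) * (t + 2)" using m t0 by (intro mult_mono) auto
  moreover have "real q = real k + real m * (m + 1) + 1" by (simp add: q_def algebra_simps)
  ultimately have "q \<le> t\<^sup>2 / 4 + 2 + (t + 1) * (t + 2)" using k(2) by linarith
  also have "\<dots> \<le> 3 * t\<^sup>2"
  proof -
    have "4 * t \<le> t * t" using t4 by (intro mult_right_mono) auto
    moreover have "(t + 1) * (t + 2) = t * t + 3 * t + 2" by (simp add: algebra_simps)
    ultimately show ?thesis using t4 unfolding power2_eq_square by linarith
  qed
  finally have "real L * real q \<le> (l + l) * (3 * t\<^sup>2)" using L l by (intro mult_mono) auto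
  also have "\<dots> \<le> (11 * l * t) * t" using l by (simp add: power2_eq_square)
  also have "\<dots> \<le> s * m" using m st s0 by (simp add: mult_left_mono)
  finally have Lq: "real (L * q) \<le> s * m" by simp
  have Lq0: "0 < L * q" by (simp add: L_def q_def)
  \<comment> \<open>As \<open>l > 1\<close>, \<open>s\<close> is at least \<open>3 * t\<close>, so
    the moves lost with one incomplete group, at most \<open>m\<close>, fit into the allowance
    \<open>s - 1\<close>.\<close>
  have "t * 2 \<le> t * (11 * l - 1)" using t0 l by (intro mult_left_mono) auto
  also have "\<dots> = s - t" by (simp add: st algebra_simps)
  finally have "m \<le> s - 1" using m t4 by linarith
  have "H < (N + 1) * (L * q)"
    unfolding N_def using Lq0 by (metis Suc_eq_plus1 dividend_less_div_times mult_Suc add.commute)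
  then have "real H < real (N + 1) * real (L * q)" by (metis of_nat_less_iff of_nat_mult)
  also have "\<dots> \<le> real (N + 1) * (s * m)" using Lq by (intro mult_left_mono) auto
  finally have "real H / s < real (N + 1) * m" using s0 by (simp add: field_simps)
  moreover have "d / (4 * s) \<le> real H / s" using d s0 by (simp add: field_simps)
  ultimately have "d / (4 * s) - m < real (N * m)" by (simp add: algebra_simps)
  then have "K < real (N * m)" using Kd \<open>m \<le> s - 1\<close> by linarith
  then have "\<lfloor>K\<rfloor> < int (N * m)" by (simp add: floor_less_iff)
  then have "k \<le> N * m" using \<open>0 \<le> K\<close> by (simp add: k_def nat_less_iff Suc_le_eq)
  show ?thesis
    by (rule that[OF \<open>n < 2 ^ L\<close> _ _ \<open>k \<le> N * m\<close> k(1), of q])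
      (simp_all add: q_def N_def)
qed

theorem theorem4p1:
  fixes V :: "'a set" and E :: "'a set set" and n :: nat and s d :: real
  assumes "simple_graph V E"
    and "card V = n"
    and "s = real n powr (1/3) * (11 * log 2 (real n)) powr (2/3)"
    and "s \<le> real n - 2"
    and "average_degree V E = d"
    and "d > 2"
  shows "real (altitude V E) >
           d / (4 * s) * (1 - 2 / d) * (1 - 1 / s) * (1 - 4 * s^2 / (d - 2))"
proof -
  let ?K = "d / (4 * s) * (1 - 2 / d) * (1 - 1 / s) * (1 - 4 * s^2 / (d - 2))"
  have V: "finite V" "\<forall>e\<in>E. e \<subseteq> V" and E2: "\<forall>e\<in>E. card e = 2"
    using assms(1) by (auto simp: simple_graph_def)
  have E: "finite E" using V by (meson PowI finite_Pow_iff finite_subset subsetI)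
  have "d * n = 2 * real (card E)"
    using assms(2,5,6) handshake[OF assms(1)]
    by (auto simp: average_degree_def simp flip: of_nat_sum)
  have "n > 0" using assms(2,5,6) by (auto simp: average_degree_def intro: gr0I)
  then have "E \<noteq> {}" using \<open>d * n = _\<close> assms(6) by auto
  have "(\<Sum>v\<in>V. degree E v) \<le> n * n"
    using sum_bounded_above[of V "degree E" n] degree_le[OF assms(1)] assms(2) by simp
  then have "d * n \<le> real n * n"
    using \<open>d * n = _\<close> handshake[OF assms(1)] by (simp flip: of_nat_mult)
  then have dn: "d \<le> n" using \<open>n > 0\<close> by simp
  show ?thesis
  proof (cases "0 \<le> ?K")
    case False
    then show ?thesis by (simp add: less_le_trans)
  next
    case True
    \<comment> \<open>A column height is an integer, so a height of at least \<open>d / 2\<close> is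
      at least \<open>H\<close>.\<close>
    define H where "H = nat \<lceil>d / 2\<rceil>"
    have dH: "d \<le> 2 * real H" unfolding H_def using assms(6) by linarith
    obtain L k m N q :: nat where
      par: "n < 2 ^ L" "k + m * (m + 1) + 1 \<le> q" "N * (L * q) \<le> H" "k \<le> N * m" "?K < real k"
      by (rule parameters[OF assms(3,6) dn dH True])
    have "k \<le> altitude V E"
    proof (rule altitude_ge[OF V(1)])
      fix r assume "linear_order_on E r"
      then obtain g :: "'a set \<Rightarrow> nat" where g: "inj_on g E"
        "\<And>e e'. e \<in> E \<Longrightarrow> e' \<in> E \<Longrightarrow> g e < g e' \<Longrightarrow> (e, e') \<in> r \<and> e \<noteq> e'"
        using rank_of_linear_order[OF E] by metis
      obtain h c where "height_table E g h c" using height_table_exists[OF E g(1) E2] by blast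
      then interpret height_table E g h c .
      have EV: "\<Union>E \<subseteq> V" using V(2) by blast
      obtain v where v: "card E \<le> h v * n"
        using tall_column[OF E V(1) EV \<open>E \<noteq> {}\<close>] assms(2) by blast
      then have "real (card E) \<le> real (h v) * n" by (simp flip: of_nat_mult)
      then have "d * n \<le> 2 * real (h v) * n" using \<open>d * n = _\<close> by simp
      then have "d \<le> 2 * real (h v)" using \<open>n > 0\<close> by simp
      then have hv: "H \<le> h v" "0 < h v" unfolding H_def using assms(6) by linarith+
      have "card (\<Union>E) < 2 ^ L" using card_mono[OF V(1) EV] assms(2) par(1) by simp
      then obtain xs where xs: "inc_path E g xs" "k < length xs"
        using long_path[OF E E2 g(1) _ par(2) hv(2) order_trans[OF par(3) hv(1)] par(4)] by blast
      \<comment> \<open>The altitude asks for length exactly \<open>k\<close>, so the path is cut to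
        \<open>k + 1\<close> vertices.\<close>
      define ys where "ys = take (Suc k) xs"
      have ys: "inc_path E g ys" unfolding ys_def by (rule inc_path_take[OF xs(1)])
      have "set (path_edges ys) \<subseteq> E" "sorted_wrt (\<lambda>e e'. g e < g e') (path_edges ys)"
        using ys by (simp_all add: inc_path_def)
      then have "sorted_wrt (\<lambda>e e'. (e, e') \<in> r \<and> e \<noteq> e') (path_edges ys)"
        using g(2) by (blast intro: sorted_wrt_mono_rel[of _ "\<lambda>e e'. g e < g e'"])
      then have "monotone_path V E r ys"
        using ys EV by (auto simp: monotone_path_def is_path_def inc_path_def)
      moreover have "path_length ys = k" using xs(2) by (simp add: ys_def path_length_def)
      ultimately show "\<exists>xs. monotone_path V E r xs \<and> path_length xs = k" by blast
    qed
    then show ?thesis using par(5) by (meson less_le_trans of_nat_le_iff)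
  qed
qed

end
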